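(* Every finite $4$-centralizer group is super integral; that is, if $G$ is a finite group with exactly $4$ distinct element centralizers, then $G$ is super integral.
   Context: For a group $G$ and $x\in G$ let $C_G(x)=\{y\in G: xy=yx\}$; $G$ is called an $n$-centralizer group if $|\{C_G(x): x\in G\}|=n$. The commuting graph $\Gamma_G$ of a finite non-abelian group $G$ with center $Z(G)$ is the simple undirected graph with vertex set $G\setminus Z(G)$ in which two distinct vertices $x,y$ are adjacent if and only if $xy=yx$. Let $A$ be the adjacency matrix and $D$ the (diagonal) degree matrix of $\Gamma_G$. A finite non-abelian group $G$ is called super integral if all eigenvalues of $A$, all eigenvalues of the Laplacian matrix $D-A$, and all eigenvalues of the signless Laplacian matrix $D+A$ are integers. *)

theory Defs
  imports
    "HOL-Algebra.Group"
    "Graph_Theory.Pair_Digraph"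
    "Jordan_Normal_Form.Spectral_Radius"
begin

definition centralizer :: "('a, 'b) monoid_scheme \<Rightarrow> 'a \<Rightarrow> 'a set" where
  "centralizer G x = {y \<in> carrier G. x \<otimes>\<^bsub>G\<^esub> y = y \<otimes>\<^bsub>G\<^esub> x}"

definition n_centralizer_group :: "nat \<Rightarrow> ('a, 'b) monoid_scheme \<Rightarrow> bool" where
  "n_centralizer_group n G \<longleftrightarrow> group G \<and> card {centralizer G x | x. x \<in> carrier G} = n"

definition group_center :: "('a, 'b) monoid_scheme \<Rightarrow> 'a set" where
  "group_center G = {z \<in> carrier G. \<forall>x \<in> carrier G. z \<otimes>\<^bsub>G\<^esub> x = x \<otimes>\<^bsub>G\<^esub> z}"

definition commuting_graph :: "('a, 'b) monoid_scheme \<Rightarrow> 'a pair_pre_digraph" where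
  "commuting_graph G = \<lparr> pverts = carrier G - group_center G,
     parcs = {(x, y). x \<in> carrier G - group_center G \<and> y \<in> carrier G - group_center G \<and>
                      x \<noteq> y \<and> x \<otimes>\<^bsub>G\<^esub> y = y \<otimes>\<^bsub>G\<^esub> x} \<rparr>"

text \<open>An undirected edge is represented by a pair of opposite arcs; \<^locale>\<open>pair_graph\<close> is the
  locale of finite simple undirected graphs in this encoding.\<close>

lemma pair_graph_commuting_graph:
  assumes "finite (carrier G)"
  shows "pair_graph (commuting_graph G)"
proof -
  have "finite (parcs (commuting_graph G))"
    by (rule finite_subset[of _ "carrier G \<times> carrier G"])
      (use assms in \<open>auto simp: commuting_graph_def\<close>)
  then show ?thesis
    using assms
    by unfold_locales (auto simp: commuting_graph_def symmetric_def intro!: symI)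
qed

text \<open>The matrices of a graph are taken with respect to an enumeration \<open>vs\<close> of its vertices,
  and over the complex numbers, so that no eigenvalue is lost.\<close>

definition adjacency_mat :: "'a pair_pre_digraph \<Rightarrow> 'a list \<Rightarrow> complex mat" where
  "adjacency_mat \<Gamma> vs = mat (length vs) (length vs)
     (\<lambda>(i, j). if (vs ! i, vs ! j) \<in> parcs \<Gamma> then 1 else 0)"

text \<open>Since edges are pairs of opposite arcs, the out-degree is the degree of the undirected
  graph.\<close>

definition degree_mat :: "'a pair_pre_digraph \<Rightarrow> 'a list \<Rightarrow> complex mat" where
  "degree_mat \<Gamma> vs = mat (length vs) (length vs)
     (\<lambda>(i, j). if i = j then of_nat (out_degree (with_proj \<Gamma>) (vs ! i)) else 0)"

definition laplacian_mat :: "'a pair_pre_digraph \<Rightarrow> 'a list \<Rightarrow> complex mat" where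
  "laplacian_mat \<Gamma> vs = degree_mat \<Gamma> vs - adjacency_mat \<Gamma> vs"

definition signless_laplacian_mat :: "'a pair_pre_digraph \<Rightarrow> 'a list \<Rightarrow> complex mat" where
  "signless_laplacian_mat \<Gamma> vs = degree_mat \<Gamma> vs + adjacency_mat \<Gamma> vs"

text \<open>The spectra do not depend on the enumeration of the vertices. Quantifying over all of them
  avoids a choice; by finiteness there is at least one, so the condition is not vacuous.\<close>

definition super_integral :: "('a, 'b) monoid_scheme \<Rightarrow> bool" where
  "super_integral G \<longleftrightarrow> group G \<and> finite (carrier G) \<and> \<not> comm_group G \<and>
     (\<forall>vs. distinct vs \<and> set vs = pverts (commuting_graph G) \<longrightarrow>
        spectrum (adjacency_mat (commuting_graph G) vs) \<subseteq> \<int> \<and>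
        spectrum (laplacian_mat (commuting_graph G) vs) \<subseteq> \<int> \<and>
        spectrum (signless_laplacian_mat (commuting_graph G) vs) \<subseteq> \<int>)"

end

theory Submission
  imports Defs
begin

text \<open>The three proper centralizers cover the group, and no two of them do. Hence an element lying
  in two of them lies in the third as well, and so is central. Consequently commuting non-central
  elements have the same centralizer and the commuting graph is a disjoint union of cliques. On a
  clique of size \<open>m\<close> each of the three matrices acts as \<open>a I + s J\<close> with integers \<open>a\<close>, \<open>s\<close> and the
  all-ones matrix \<open>J\<close>, so its eigenvalues are among \<open>a\<close> and \<open>a + s m\<close>.\<close>

text \<open>Here \<open>R\<close> labels each index by its clique. The eigenvector equation is read
  only on one clique \<open>K\<close> on which the eigenvector does not vanish, so the indices need
  not be sorted into blocks.\<close>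

lemma spectrum_cliques_subset_Ints:
  fixes M :: "complex mat" and R :: "nat \<Rightarrow> 'c" and a :: "'c \<Rightarrow> int" and s :: int
  assumes M: "M = mat n n (\<lambda>(i, j). (if i = j then of_int (a (R i)) else 0)
                                 + (if R i = R j then of_int s else 0))"
  shows "spectrum M \<subseteq> \<int>"
proof
  fix k assume "k \<in> spectrum M"
  then have ev: "eigenvalue M k"
    by (simp add: spectrum_def)
  have Mc: "M \<in> carrier_mat n n"
    by (simp add: M)
  then obtain v where v: "v \<in> carrier_vec n" "v \<noteq> 0\<^sub>v n" "M *\<^sub>v v = k \<cdot>\<^sub>v v"
    using ev unfolding eigenvalue_def eigenvector_def by auto
  then obtain i where i: "i < n" "v $ i \<noteq> 0"
    by (metis carrier_vecD eq_vecI index_zero_vec(1) index_zero_vec(2))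
  define K where "K = {j \<in> {0..<n}. R j = R i}"
  define S where "S = (\<Sum>j\<in>K. v $ j)"
  define \<alpha> :: complex where "\<alpha> = of_int (a (R i))"
  have inS: "(\<Sum>l\<in>{0..<n}. if R l = R i then of_int s * v $ l else 0) = of_int s * S"
    unfolding S_def K_def sum_distrib_left by (rule sum.inter_filter[symmetric]) simp
  \<comment> \<open>In a row of \<open>K\<close>, the part \<open>s J\<close> produces the same
    value \<open>s * S\<close> for every \<open>j\<close>; only the diagonal part sees
    \<open>v $ j\<close> itself.\<close>
  have row: "(k - \<alpha>) * v $ j = of_int s * S" if j: "j \<in> K" for j
  proof -
    have jn: "j < n" and Rj: "R j = R i"
      using j by (auto simp: K_def)
    have "k * v $ j = (M *\<^sub>v v) $ j"
      using v jn by auto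
    also have "\<dots> = (\<Sum>l\<in>{0..<n}. M $$ (j, l) * v $ l)"
      using v(1) Mc jn by (auto simp: scalar_prod_def intro!: sum.cong)
    also have "\<dots> = (\<Sum>l\<in>{0..<n}. (if j = l then \<alpha> * v $ l else 0)
                                 + (if R l = R i then of_int s * v $ l else 0))"
      using jn Rj by (intro sum.cong) (auto simp: M \<alpha>_def algebra_simps)
    also have "\<dots> = \<alpha> * v $ j + of_int s * S"
      using jn by (simp add: sum.distrib inS)
    finally show ?thesis
      by (simp add: algebra_simps)
  qed
  show "k \<in> \<int>"
  proof (cases "S = 0")
    case True
    \<comment> \<open>Row \<open>i\<close> reads \<open>(k - \<alpha>) * v $ i = 0\<close>, and
      \<open>v $ i\<close> is nonzero by the choice of \<open>i\<close>.\<close>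
    then have "k = \<alpha>"
      using row[of i] i by (simp add: K_def)
    then show ?thesis
      by (simp add: \<alpha>_def)
  next
    case False
    \<comment> \<open>Adding up the rows of \<open>K\<close> gives a scalar equation in which the
      nonzero \<open>S\<close> cancels.\<close>
    have "(k - \<alpha>) * S = (\<Sum>j\<in>K. (k - \<alpha>) * v $ j)"
      by (simp add: S_def sum_distrib_left)
    also have "\<dots> = (of_nat (card K) * of_int s) * S"
      using row by simp
    finally have "k - \<alpha> = of_nat (card K) * of_int s"
      using False by simp
    then have "k = \<alpha> + of_nat (card K) * of_int s"
      by (simp add: algebra_simps)
    then show ?thesis
      by (simp add: \<alpha>_def)
  qed
qed

lemma (in group) subgroup_mult_left_iff:
  assumes "subgroup H G" "x \<in> H" "y \<in> carrier G"
  shows "x \<otimes> y \<in> H \<longleftrightarrow> y \<in> H"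
proof
  assume "x \<otimes> y \<in> H"
  then have "inv x \<otimes> (x \<otimes> y) \<in> H"
    using assms by (meson subgroup.m_closed subgroup.m_inv_closed)
  then show "y \<in> H"
    using assms by (simp add: m_assoc[symmetric] subgroup.mem_carrier)
qed (use assms in \<open>auto intro: subgroup.m_closed\<close>)

lemma (in group) subgroup_mult_right_iff:
  assumes "subgroup H G" "y \<in> H" "x \<in> carrier G"
  shows "x \<otimes> y \<in> H \<longleftrightarrow> x \<in> H"
proof
  assume "x \<otimes> y \<in> H"
  then have "(x \<otimes> y) \<otimes> inv y \<in> H"
    using assms by (meson subgroup.m_closed subgroup.m_inv_closed)
  moreover have "y \<in> carrier G"
    using assms(1,2) by (rule subgroup.mem_carrier)
  ultimately show "x \<in> H"
    using assms(3) by (simp add: m_assoc)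
qed (use assms in \<open>auto intro: subgroup.m_closed\<close>)

text \<open>Take \<open>a\<close> outside \<open>A\<close> and \<open>b\<close> outside
  \<open>B\<close>. If neither avoids both subgroups, then \<open>a\<close> is in \<open>B\<close>
  and \<open>b\<close> is in \<open>A\<close>, so the product \<open>a \<otimes> b\<close> avoids
  both.\<close>

lemma (in group) union_two_proper_subgroups:
  assumes A: "subgroup A G" "A \<noteq> carrier G" and B: "subgroup B G" "B \<noteq> carrier G"
  obtains x where "x \<in> carrier G" "x \<notin> A" "x \<notin> B"
proof -
  obtain a b where a: "a \<in> carrier G" "a \<notin> A" and b: "b \<in> carrier G" "b \<notin> B"
    using A B subgroup.subset by blast
  have "a \<otimes> b \<notin> A \<and> a \<otimes> b \<notin> B" if "a \<in> B" "b \<in> A"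
    using that a b A B subgroup_mult_left_iff subgroup_mult_right_iff by blast
  then show thesis
    using that a b by (meson m_closed)
qed

text \<open>Multiplying an element \<open>c\<close> outside \<open>A\<close> and \<open>B\<close> by
  \<open>d\<close> from their intersection stays outside both. So \<open>C\<close> contains
  \<open>c\<close> and \<open>d \<otimes> c\<close>, and therefore their quotient
  \<open>d\<close>.\<close>

lemma (in group) three_subgroup_cover_Int:
  assumes A: "subgroup A G" "A \<noteq> carrier G" and B: "subgroup B G" "B \<noteq> carrier G"
    and C: "subgroup C G" and cover: "carrier G \<subseteq> A \<union> B \<union> C"
  shows "A \<inter> B \<subseteq> C"
proof
  fix d assume d: "d \<in> A \<inter> B"
  then have dG: "d \<in> carrier G"
    using subgroup.mem_carrier[OF A(1)] by simp
  obtain c where c: "c \<in> carrier G" "c \<notin> A" "c \<notin> B"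
    using union_two_proper_subgroups[OF A B] .
  then have "d \<otimes> c \<notin> A" "d \<otimes> c \<notin> B"
    using d A(1) B(1) subgroup_mult_left_iff by auto
  then have "d \<otimes> c \<in> C" "c \<in> C"
    using c cover m_closed[OF dG c(1)] by blast+
  then show "d \<in> C"
    using subgroup_mult_right_iff[OF C] dG by blast
qed

lemma (in group) subgroup_centralizer:
  assumes x: "x \<in> carrier G"
  shows "subgroup (centralizer G x) G"
proof (rule subgroupI)
  show "a \<otimes> b \<in> centralizer G x" if "a \<in> centralizer G x" "b \<in> centralizer G x" for a b
  proof -
    have ab: "a \<in> carrier G" "b \<in> carrier G" "x \<otimes> a = a \<otimes> x" "x \<otimes> b = b \<otimes> x"
      using that by (auto simp: centralizer_def)
    have "x \<otimes> (a \<otimes> b) = a \<otimes> (x \<otimes> b)"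
      using x ab(1-3) by (simp add: m_assoc[symmetric])
    also have "\<dots> = a \<otimes> b \<otimes> x"
      using x ab by (simp add: m_assoc)
    finally show ?thesis
      using ab by (simp add: centralizer_def)
  qed
  show "inv a \<in> centralizer G x" if "a \<in> centralizer G x" for a
  proof -
    have a: "a \<in> carrier G" "a \<otimes> x = x \<otimes> a"
      using that by (auto simp: centralizer_def)
    have "a \<otimes> (x \<otimes> inv a) = a \<otimes> x \<otimes> inv a"
      using x a(1) by (simp add: m_assoc)
    also have "\<dots> = x"
      unfolding a(2) using x a(1) by (simp add: m_assoc)
    finally have "x \<otimes> inv a = inv a \<otimes> x"
      using x a(1) by (simp add: inv_solve_left)
    then show ?thesis
      using a by (simp add: centralizer_def)
  qed
qed (use x in \<open>auto simp: centralizer_def\<close>)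

lemma (in group) centralizer_eq_carrier_iff:
  "x \<in> carrier G \<Longrightarrow> centralizer G x = carrier G \<longleftrightarrow> x \<in> group_center G"
  by (auto simp: centralizer_def group_center_def)

lemma (in group) four_centralizer_commute_iff:
  assumes four: "n_centralizer_group 4 G"
    and x: "x \<in> carrier G - group_center G" and y: "y \<in> carrier G - group_center G"
  shows "x \<otimes> y = y \<otimes> x \<longleftrightarrow> centralizer G x = centralizer G y"
proof
  assume "centralizer G x = centralizer G y"
  then show "x \<otimes> y = y \<otimes> x"
    using y by (auto simp: centralizer_def)
next
  assume xy: "x \<otimes> y = y \<otimes> x"
  define \<C> where "\<C> = {centralizer G x | x. x \<in> carrier G} - {carrier G}"
  \<comment> \<open>The whole group is the centralizer of the identity, so exactly three proper
    centralizers remain.\<close>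
  have "carrier G \<in> {centralizer G x | x. x \<in> carrier G}"
    using centralizer_eq_carrier_iff[of \<one>] by (force simp: group_center_def)
  then have "card \<C> = 3"
    using four by (simp add: \<C>_def n_centralizer_group_def)
  have sub: "subgroup A G" "A \<noteq> carrier G" if "A \<in> \<C>" for A
    using that subgroup_centralizer by (auto simp: \<C>_def)
  have mem: "centralizer G z \<in> \<C>" if "z \<in> carrier G - group_center G" for z
    using that centralizer_eq_carrier_iff by (auto simp: \<C>_def)
  show "centralizer G x = centralizer G y"
  proof (rule ccontr)
    assume ne: "centralizer G x \<noteq> centralizer G y"
    obtain C where \<C>: "\<C> = {centralizer G x, centralizer G y, C}"
    proof -
      have "card (\<C> - {centralizer G x, centralizer G y}) = 1"
        using \<open>card \<C> = 3\<close> ne mem[OF x] mem[OF y] by (subst card_Diff_subset) auto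
      then obtain C where "\<C> - {centralizer G x, centralizer G y} = {C}"
        by (rule card_1_singletonE)
      then show thesis
        using mem[OF x] mem[OF y] by (intro that[of C]) blast
    qed
    \<comment> \<open>A non-central element lies in its own proper centralizer, a central one in
      every centralizer.\<close>
    have "\<Union>\<C> \<supseteq> carrier G"
    proof
      fix z assume z: "z \<in> carrier G"
      show "z \<in> \<Union>\<C>"
      proof (cases "z \<in> group_center G")
        case True
        then have "z \<in> centralizer G x"
          using x by (auto simp: centralizer_def group_center_def)
        then show ?thesis
          using mem[OF x] by (rule UnionI[rotated])
      next
        case False
        then have "centralizer G z \<in> \<C>"
          using z mem by simp
        moreover have "z \<in> centralizer G z"
          using z by (simp add: centralizer_def)
        ultimately show ?thesis
          by (rule UnionI)
      qed
    qed
    then have "centralizer G x \<inter> centralizer G y \<subseteq> C"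
      using \<C> sub by (intro three_subgroup_cover_Int) auto
    moreover have "x \<in> centralizer G x \<inter> centralizer G y"
      using x xy by (auto simp: centralizer_def)
    ultimately have "x \<in> A" if "A \<in> \<C>" for A
      using that \<C> by auto
    \<comment> \<open>The only centralizer left out of \<open>\<C>\<close> is the whole group, which
      contains \<open>x\<close> anyway.\<close>
    then have "x \<in> centralizer G z" if "z \<in> carrier G" for z
      using x that centralizer_eq_carrier_iff by (auto simp: \<C>_def)
    then have "x \<in> group_center G"
      using x by (auto simp: centralizer_def group_center_def)
    then show False
      using x by simp
  qed
qed

text \<open>With \<open>n = 4\<close> this yields the non-commutativity that
  \<open>super_integral\<close> demands.\<close>

lemma (in group) n_centralizer_comm_group:
  assumes "comm_group G" "n_centralizer_group n G"
  shows "n = 1"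
proof -
  interpret comm_group G by fact
  have "centralizer G x = carrier G" if "x \<in> carrier G" for x
    using that by (auto simp: centralizer_def m_comm)
  then have "{centralizer G x | x. x \<in> carrier G} = {carrier G}"
    by (auto intro!: exI[of _ \<one>])
  then show ?thesis
    using assms by (simp add: n_centralizer_group_def)
qed

theorem theorem3p1:
  fixes G :: "('a, 'b) monoid_scheme"
  assumes "finite (carrier G)"
    and "n_centralizer_group 4 G"
  shows "super_integral G"
proof -
  interpret group G
    using assms by (simp add: n_centralizer_group_def)
  let ?\<Gamma> = "commuting_graph G"
  have arc: "(x, y) \<in> parcs ?\<Gamma> \<longleftrightarrow> x \<noteq> y \<and> centralizer G x = centralizer G y"
    if "x \<in> pverts ?\<Gamma>" "y \<in> pverts ?\<Gamma>" for x y
    using that four_centralizer_commute_iff[OF assms(2)] by (simp add: commuting_graph_def)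
  \<comment> \<open>The degree is expressed through the centralizer alone, so that it is constant on
    cliques. The subtracted 1 is the vertex itself; for the centralizer of a vertex the class is
    nonempty, so the subtraction does not truncate.\<close>
  define deg where "deg C = card {y \<in> pverts ?\<Gamma>. centralizer G y = C} - 1" for C
  have deg: "out_degree (with_proj ?\<Gamma>) x = deg (centralizer G x)" if x: "x \<in> pverts ?\<Gamma>" for x
  proof -
    let ?K = "{y \<in> pverts ?\<Gamma>. centralizer G y = centralizer G x}"
    have "parcs ?\<Gamma> \<subseteq> pverts ?\<Gamma> \<times> pverts ?\<Gamma>"
      by (auto simp: commuting_graph_def)
    then have "out_arcs (with_proj ?\<Gamma>) x = Pair x ` (?K - {x})"
      using x arc by (fastforce simp: out_arcs_def)
    then have "out_degree (with_proj ?\<Gamma>) x = card (?K - {x})"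
      by (simp add: out_degree_def card_image inj_on_def)
    then show ?thesis
      using x by (simp add: deg_def)
  qed
  show ?thesis
    unfolding super_integral_def
  proof (intro conjI allI impI)
    show "\<not> comm_group G"
      using n_centralizer_comm_group[OF _ assms(2)] by auto
  next
    fix vs assume vs: "distinct vs \<and> set vs = pverts ?\<Gamma>"
    let ?R = "\<lambda>i. centralizer G (vs ! i)"
    have V: "vs ! i \<in> pverts ?\<Gamma>" if "i < length vs" for i
      using that vs nth_mem by blast
    \<comment> \<open>Distinctness of \<open>vs\<close> lets \<open>i \<noteq> j\<close> replace
      inequality of the vertices.\<close>
    have A: "(vs ! i, vs ! j) \<in> parcs ?\<Gamma> \<longleftrightarrow> i \<noteq> j \<and> ?R i = ?R j"
      if "i < length vs" "j < length vs" for i j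
      using that arc V vs by (simp add: nth_eq_iff_index_eq)
    note mat_simps = adjacency_mat_def laplacian_mat_def signless_laplacian_mat_def
      degree_mat_def A V deg
    \<comment> \<open>The part \<open>s J\<close> also adds \<open>s\<close> on the diagonal, so
      \<open>a\<close> must be the diagonal entry minus \<open>s\<close>: this gives
      \<open>- 1\<close> for the adjacency matrix, \<open>deg + 1\<close> for the Laplacian, where
      \<open>s = - 1\<close>, and \<open>deg - 1\<close> for the signless Laplacian.\<close>
    show "spectrum (adjacency_mat ?\<Gamma> vs) \<subseteq> \<int>"
      by (rule spectrum_cliques_subset_Ints[of _ "length vs" "\<lambda>_. - 1" ?R 1], rule eq_matI)
        (auto simp: mat_simps)
    show "spectrum (laplacian_mat ?\<Gamma> vs) \<subseteq> \<int>"
      by (rule spectrum_cliques_subset_Ints[of _ "length vs" "\<lambda>C. int (deg C) + 1" ?R "- 1"], rule eq_matI)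
        (auto simp: mat_simps)
    show "spectrum (signless_laplacian_mat ?\<Gamma> vs) \<subseteq> \<int>"
      by (rule spectrum_cliques_subset_Ints[of _ "length vs" "\<lambda>C. int (deg C) - 1" ?R 1], rule eq_matI)
        (auto simp: mat_simps)
  qed (use assms in auto)
qed

end
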